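(* Let $R$ be an associative ring with unity $1$ and let $a,b,c\in R$. Then $a$ is $(b,c)$-polar if and only if $a$ is $(b,c)$-invertible. In this case, writing $p=a_l^{(b,c)\pi}$ and $q=a_r^{(b,c)\pi}$ for the left and right $(b,c)$-spectral idempotents of $a$, and $a^{\|(b,c)}$ for the $(b,c)$-inverse of $a$, one has: (i) $p=a^{\|(b,c)}a$; (ii) $q=aa^{\|(b,c)}$; (iii) $b$, $c$ and $cab$ are regular, and for any inner inverses $b^-$, $c^-$, $(cab)^-$ of $b$, $c$, $cab$ respectively, the element $1+p-bb^-$ is left invertible, the element $1+q-c^-c$ is right invertible, and $$a^{\|(b,c)}=(1+p-bb^-)_l^{-1}\,b(cab)^-c=b(cab)^-c\,(1+q-c^-c)_r^{-1},$$ where $(1+p-bb^-)_l^{-1}$ denotes any left inverse of $1+p-bb^-$ and $(1+q-c^-c)_r^{-1}$ denotes any right inverse of $1+q-c^-c$.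
   Context: An element $x\in R$ is regular if $x=xzx$ for some $z\in R$; any such $z$ is called an inner inverse of $x$ and is denoted $x^-$. $(b,c)$-polar: $a$ is $(b,c)$-polar if there exist $p,q\in R$ such that (1) $p^2=p\in bRca$; (2) $q^2=q\in abRc$; (3) $pb=b$ and $cq=c$; (4) $cap=ca$ and $qab=ab$. Here $bRca=\{btca: t\in R\}$ and $abRc=\{abtc: t\in R\}$. Such $p$ and $q$ are unique when they exist; $p$ is called the left $(b,c)$-spectral idempotent of $a$, denoted $a_l^{(b,c)\pi}$, and $q$ the right $(b,c)$-spectral idempotent of $a$, denoted $a_r^{(b,c)\pi}$. $(b,c)$-invertible (Drazin): $a$ is $(b,c)$-invertible if there exists $y\in bR\cap Rc$ with $yab=b$ and $cay=c$. Such $y$ is unique when it exists; it is called the $(b,c)$-inverse of $a$ and denoted $a^{\|(b,c)}$. *)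

theory Defs
  imports Main
begin

text \<open>
  Associative rings with unity are types of sort \<open>{ring, monoid_mult}\<close>. Unlike the class
  \<open>ring_1\<close>, this sort does not require \<open>0 \<noteq> 1\<close>, so the zero ring is included.
\<close>

definition inner_inverse :: "'a::semigroup_mult \<Rightarrow> 'a \<Rightarrow> bool" where
  "inner_inverse x z \<longleftrightarrow> x = x * z * x"

definition regular_elem :: "'a::semigroup_mult \<Rightarrow> bool" where
  "regular_elem x \<longleftrightarrow> (\<exists>z. inner_inverse x z)"

definition left_inverse_of :: "'a::monoid_mult \<Rightarrow> 'a \<Rightarrow> bool" where
  "left_inverse_of x u \<longleftrightarrow> u * x = 1"

definition right_inverse_of :: "'a::monoid_mult \<Rightarrow> 'a \<Rightarrow> bool" where
  "right_inverse_of x v \<longleftrightarrow> x * v = 1"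

definition left_invertible :: "'a::monoid_mult \<Rightarrow> bool" where
  "left_invertible x \<longleftrightarrow> (\<exists>u. left_inverse_of x u)"

definition right_invertible :: "'a::monoid_mult \<Rightarrow> bool" where
  "right_invertible x \<longleftrightarrow> (\<exists>v. right_inverse_of x v)"

definition bc_spectral_pair ::
    "'a::{ring, monoid_mult} \<Rightarrow> 'a \<Rightarrow> 'a \<Rightarrow> 'a \<Rightarrow> 'a \<Rightarrow> bool" where
  "bc_spectral_pair a b c p q \<longleftrightarrow>
     p\<^sup>2 = p \<and> p \<in> {b * t * c * a | t. True} \<and>
     q\<^sup>2 = q \<and> q \<in> {a * b * t * c | t. True} \<and>
     p * b = b \<and> c * q = c \<and>
     c * a * p = c * a \<and> q * a * b = a * b"

definition bc_polar :: "'a::{ring, monoid_mult} \<Rightarrow> 'a \<Rightarrow> 'a \<Rightarrow> bool" where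
  "bc_polar a b c \<longleftrightarrow> (\<exists>p q. bc_spectral_pair a b c p q)"

definition is_bc_inverse :: "'a::{ring, monoid_mult} \<Rightarrow> 'a \<Rightarrow> 'a \<Rightarrow> 'a \<Rightarrow> bool" where
  "is_bc_inverse a b c y \<longleftrightarrow>
     y \<in> {b * t | t. True} \<inter> {t * c | t. True} \<and> y * a * b = b \<and> c * a * y = c"

definition bc_invertible :: "'a::{ring, monoid_mult} \<Rightarrow> 'a \<Rightarrow> 'a \<Rightarrow> bool" where
  "bc_invertible a b c \<longleftrightarrow> (\<exists>y. is_bc_inverse a b c y)"

text \<open>
  The uniqueness lemmas below justify the definite descriptions; the described elements are
  meaningful only when \<open>a\<close> is \<open>(b,c)\<close>-polar, respectively \<open>(b,c)\<close>-invertible.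
\<close>

definition left_spectral_idem :: "'a::{ring, monoid_mult} \<Rightarrow> 'a \<Rightarrow> 'a \<Rightarrow> 'a" where
  "left_spectral_idem a b c = (THE p. \<exists>q. bc_spectral_pair a b c p q)"

definition right_spectral_idem :: "'a::{ring, monoid_mult} \<Rightarrow> 'a \<Rightarrow> 'a \<Rightarrow> 'a" where
  "right_spectral_idem a b c = (THE q. \<exists>p. bc_spectral_pair a b c p q)"

definition bc_inverse :: "'a::{ring, monoid_mult} \<Rightarrow> 'a \<Rightarrow> 'a \<Rightarrow> 'a" where
  "bc_inverse a b c = (THE y. is_bc_inverse a b c y)"

lemma bc_spectral_pair_unique:
  assumes "bc_spectral_pair a b c p q" and "bc_spectral_pair a b c p' q'"
  shows "p = p'" and "q = q'"
proof -
  obtain s s' t t' where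
    s: "p = b * s * c * a" and s': "p' = b * s' * c * a" and
    t: "q = a * b * t * c" and t': "q' = a * b * t' * c"
    using assms unfolding bc_spectral_pair_def by blast
  have pb: "p * b = b" and cq': "c * q' = c" and cap': "c * a * p' = c * a"
    and qab: "q * a * b = a * b"
    using assms unfolding bc_spectral_pair_def by simp_all
  have "p * p' = (p * b) * s' * c * a" by (simp add: s' mult.assoc)
  then have 1: "p * p' = p'" by (simp add: pb s')
  have "p * p' = b * s * (c * a * p')" by (simp add: s mult.assoc)
  then have 2: "p * p' = p" by (simp only: cap') (simp add: s mult.assoc)
  from 1 2 show "p = p'" by simp
  have "q * q' = (q * a * b) * t' * c" by (simp add: t' mult.assoc)
  then have 3: "q * q' = q'" by (simp add: qab t')
  have "q * q' = a * b * t * (c * q')" by (simp add: t mult.assoc)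
  then have 4: "q * q' = q" by (simp only: cq') (simp add: t)
  from 3 4 show "q = q'" by simp
qed

lemma is_bc_inverse_unique:
  assumes "is_bc_inverse a b c y" and "is_bc_inverse a b c y'"
  shows "y = y'"
proof -
  obtain s t where s: "y' = b * s" and t: "y = t * c"
    using assms unfolding is_bc_inverse_def by blast
  have yab: "y * a * b = b" and cay': "c * a * y' = c"
    using assms unfolding is_bc_inverse_def by simp_all
  have "y * a * y' = (y * a * b) * s" by (simp add: s mult.assoc)
  then have 1: "y * a * y' = y'" by (simp only: yab s)
  have "y * a * y' = t * (c * a * y')" by (simp add: t mult.assoc)
  then have 2: "y * a * y' = y" by (simp only: cay' t)
  from 1 2 show ?thesis by simp
qed

end

theory Submission imports Defs begin

text \<open>
  Both notions are governed by a single element. If \<open>w\<close> satisfies \<open>b w c a b = b\<close> and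
  \<open>c a b w c = c\<close>, then \<open>y = b w c\<close> is the \<open>(b,c)\<close>-inverse of \<open>a\<close> and the spectral idempotents are
  \<open>y a\<close> and \<open>a y\<close>. Polarity supplies two candidates for \<open>w\<close>, one with each property (from \<open>p\<close> and
  from \<open>q\<close>); the telescoping \<open>b t c = (b s c a b) t c = b s (c a b t c) = b s c\<close> shows that
  they define the same \<open>y\<close>. Conversely, a \<open>(b,c)\<close>-inverse satisfies \<open>y a y = y\<close>, and writing the outer
  factors in \<open>b R\<close> and \<open>R c\<close> exhibits \<open>y\<close> as an element of \<open>b R c\<close>. Hence polarity and
  invertibility coincide.

  The element \<open>w\<close> is an inner inverse of \<open>c a b\<close>. Although \<open>c a b\<close> may have many inner inverses, the product
  \<open>b d c\<close> is the same for all of them, because \<open>b\<close> is a left multiple of \<open>c a b\<close> and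
  \<open>c\<close> is a right multiple of it. So \<open>b d c\<close> is \<open>y\<close> itself, and the remaining factors in the two
  formulas only have to be inverses of units that fix \<open>y\<close>. They are: \<open>p\<close> and \<open>b b\<^sup>-\<close> are
  idempotents generating the same right ideal \<open>b R\<close>, so their difference squares to zero and
  kills \<open>b R\<close> from the left; dually, \<open>q\<close> and \<open>c\<^sup>- c\<close> generate the left ideal \<open>R c\<close>.
\<close>

lemma bc_spectral_pair_imp_is_bc_inverse:
  fixes a b c p q :: "'a :: {ring, monoid_mult}"
  assumes "bc_spectral_pair a b c p q"
  obtains y where "is_bc_inverse a b c y"
proof -
  obtain s t where p: "p = b * s * c * a" and q: "q = a * b * t * c"
    and pb: "p * b = b" and cq: "c * q = c"
    using assms unfolding bc_spectral_pair_def by blast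
  have "b * t * c = p * b * t * c" by (simp only: pb)
  also have "\<dots> = b * s * (c * q)" by (simp add: p q mult.assoc)
  finally have eq: "b * t * c = b * s * c" by (simp only: cq)
  have "b * s * c * a * b = b" using pb by (simp add: p)
  moreover have "c * a * (b * t * c) = c" using cq by (simp add: q mult.assoc)
  moreover have "b * t * c \<in> {b * x | x. True} \<inter> {x * c | x. True}"
    using mult.assoc[of b t c] by blast
  ultimately have "is_bc_inverse a b c (b * t * c)"
    unfolding is_bc_inverse_def by (simp only: eq)
  then show thesis by (rule that)
qed

text \<open>
  Since \<open>y = b s\<close> and \<open>y a b = b\<close>, one has \<open>y = y a y\<close>; replacing the left factor by \<open>b s\<close> and the
  right one by \<open>t c\<close> traps \<open>y\<close> between \<open>b\<close> and \<open>c\<close>. A common middle factor \<open>w\<close> yields both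
  spectral idempotents and an inner inverse of \<open>c a b\<close> at once.
\<close>

lemma is_bc_inverse_sandwich:
  fixes a b c y :: "'a :: {ring, monoid_mult}"
  assumes "is_bc_inverse a b c y"
  obtains w where "y = b * w * c"
proof -
  obtain s t where s: "y = b * s" and t: "y = t * c" and yab: "y * a * b = b"
    using assms unfolding is_bc_inverse_def by blast
  have "y = y * a * y" using yab s by (metis mult.assoc)
  also have "\<dots> = (b * s) * a * (t * c)" using s t by metis
  also have "\<dots> = b * (s * a * t) * c" by (simp add: mult.assoc)
  finally show thesis by (rule that)
qed

lemma is_bc_inverse_imp_spectral_pair:
  fixes a b c y :: "'a :: {ring, monoid_mult}"
  assumes y: "is_bc_inverse a b c y"
  shows "bc_spectral_pair a b c (y * a) (a * y)"
proof -
  obtain w where w: "y = b * w * c" using y by (rule is_bc_inverse_sandwich)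
  have yab: "y * a * b = b" and cay: "c * a * y = c"
    using y by (simp_all add: is_bc_inverse_def)
  have "y * a * y = (y * a * b) * w * c" by (simp add: w mult.assoc)
  also have "\<dots> = b * w * c" by (simp only: yab)
  finally have yay: "y * a * y = y" by (simp only: w)
  have "(y * a)\<^sup>2 = y * a" "(a * y)\<^sup>2 = a * y"
    using yay by (simp_all add: power2_eq_square mult.assoc[symmetric])
      (simp add: mult.assoc)
  moreover have "y * a = b * w * c * a" "a * y = a * b * w * c"
    by (simp_all add: w mult.assoc)
  moreover have "c * (a * y) = c" "c * a * (y * a) = c * a" "a * y * a * b = a * b"
    using yab cay by (simp_all add: mult.assoc[symmetric]) (simp add: mult.assoc)
  ultimately show ?thesis
    unfolding bc_spectral_pair_def using yab by auto
qed

lemma bc_polar_iff_bc_invertible: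
  fixes a b c :: "'a :: {ring, monoid_mult}"
  shows "bc_polar a b c \<longleftrightarrow> bc_invertible a b c"
  unfolding bc_polar_def bc_invertible_def
  using bc_spectral_pair_imp_is_bc_inverse is_bc_inverse_imp_spectral_pair by metis

lemma is_bc_inverse_imp_regular:
  fixes a b c y :: "'a :: {ring, monoid_mult}"
  assumes y: "is_bc_inverse a b c y"
  shows "regular_elem b" "regular_elem c" "regular_elem (c * a * b)"
proof -
  obtain w where w: "y = b * w * c" using y by (rule is_bc_inverse_sandwich)
  have yab: "b * w * c * a * b = b" and cay: "c * a * b * w * c = c"
    using y by (simp_all add: is_bc_inverse_def w mult.assoc)
  have "inner_inverse b (w * c * a)" "inner_inverse c (a * b * w)"
    using yab cay by (simp_all add: inner_inverse_def mult.assoc)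
  moreover have "inner_inverse (c * a * b) w"
    using yab by (simp add: inner_inverse_def mult.assoc)
  ultimately show "regular_elem b" "regular_elem c" "regular_elem (c * a * b)"
    unfolding regular_elem_def by blast+
qed

text \<open>
  With \<open>y = b w c\<close> one has \<open>b = b w (c a b)\<close> and \<open>c = (c a b) w c\<close>, so \<open>b d c\<close> depends on \<open>d\<close> only
  through \<open>(c a b) d (c a b) = c a b\<close>.
\<close>

lemma is_bc_inverse_eq_sandwich_inner_inverse:
  fixes a b c d y :: "'a :: {ring, monoid_mult}"
  assumes y: "is_bc_inverse a b c y" and d: "inner_inverse (c * a * b) d"
  shows "b * d * c = y"
proof -
  obtain w where w: "y = b * w * c" using y by (rule is_bc_inverse_sandwich)
  have yab: "y * a * b = b" and cay: "c * a * y = c"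
    using y by (simp_all add: is_bc_inverse_def)
  have "b * d * c = (y * a * b) * d * (c * a * y)" by (simp only: yab cay)
  also have "\<dots> = b * w * (c * a * b * d * (c * a * b)) * w * c"
    by (simp add: w mult.assoc)
  also have "\<dots> = b * w * (c * a * b) * w * c"
    using d by (simp only: inner_inverse_def)
  also have "\<dots> = (y * a * b) * w * c" by (simp add: w mult.assoc)
  also have "\<dots> = b * w * c" by (simp only: yab)
  finally show ?thesis by (simp only: w)
qed

lemma one_plus_square_zero_inverse:
  fixes f :: "'a :: {ring, monoid_mult}"
  assumes "f * f = 0"
  shows "(1 - f) * (1 + f) = 1" "(1 + f) * (1 - f) = 1"
  using assms by (simp_all add: algebra_simps)

text \<open>
  The two relations say that \<open>p\<close> and \<open>e\<close> are idempotents with the same right ideal. Then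
  \<open>(p - e)\<^sup>2 = p - e - p + e = 0\<close>.
\<close>

lemma left_invertible_one_plus_idem_diff:
  fixes p e :: "'a :: {ring, monoid_mult}"
  assumes "p * e = e" "e * p = p"
  shows "left_invertible (1 + p - e)"
proof -
  have "p * p = p" "e * e = e" using assms by (metis mult.assoc)+
  then have "(p - e) * (p - e) = 0" using assms by (simp add: algebra_simps)
  then show ?thesis
    using one_plus_square_zero_inverse(1)[of "p - e"]
    unfolding left_invertible_def left_inverse_of_def by (auto simp: add_diff_eq)
qed

lemma right_invertible_one_plus_idem_diff:
  fixes q e :: "'a :: {ring, monoid_mult}"
  assumes "q * e = q" "e * q = e"
  shows "right_invertible (1 + q - e)"
proof -
  have "q * q = q" "e * e = e" using assms by (metis mult.assoc)+
  then have "(q - e) * (q - e) = 0" using assms by (simp add: algebra_simps)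
  then show ?thesis
    using one_plus_square_zero_inverse(2)[of "q - e"]
    unfolding right_invertible_def right_inverse_of_def by (auto simp: add_diff_eq)
qed

text \<open>
  Both \<open>p = y a\<close> and \<open>b b'\<close> act as the identity on \<open>b R\<close> from the left, so
  \<open>1 + p - b b'\<close> fixes \<open>y\<close>, and then so does each of its left inverses.
\<close>

lemma is_bc_inverse_left_factor:
  fixes a b c b' y :: "'a :: {ring, monoid_mult}"
  assumes y: "is_bc_inverse a b c y" and b': "inner_inverse b b'"
  shows "left_invertible (1 + y * a - b * b')"
    and "left_inverse_of (1 + y * a - b * b') u \<Longrightarrow> u * y = y"
proof -
  obtain s where s: "y = b * s" and yab: "y * a * b = b"
    using y unfolding is_bc_inverse_def by blast
  have bb'b: "b * b' * b = b" using b' by (simp add: inner_inverse_def)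
  have e: "b * b' * y = y" by (metis s bb'b mult.assoc)
  have p: "y * a * y = y" by (metis s yab mult.assoc)
  have "y * a * (b * b') = b * b'" by (metis yab mult.assoc)
  moreover have "b * b' * (y * a) = y * a" by (metis e mult.assoc)
  ultimately show "left_invertible (1 + y * a - b * b')"
    by (rule left_invertible_one_plus_idem_diff)
  assume "left_inverse_of (1 + y * a - b * b') u"
  then have u: "u * (1 + y * a - b * b') = 1" by (simp add: left_inverse_of_def)
  have "(1 + y * a - b * b') * y = y"
    using e p by (simp add: left_diff_distrib distrib_right)
  then show "u * y = y" using u by (metis mult.assoc mult_1_left)
qed

lemma is_bc_inverse_right_factor:
  fixes a b c c' y :: "'a :: {ring, monoid_mult}"
  assumes y: "is_bc_inverse a b c y" and c': "inner_inverse c c'"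
  shows "right_invertible (1 + a * y - c' * c)"
    and "right_inverse_of (1 + a * y - c' * c) v \<Longrightarrow> y * v = y"
proof -
  obtain t where t: "y = t * c" and cay: "c * a * y = c"
    using y unfolding is_bc_inverse_def by blast
  have cc'c: "c * (c' * c) = c"
    using c' by (simp add: inner_inverse_def mult.assoc)
  have e: "y * (c' * c) = y" by (metis t cc'c mult.assoc)
  have q: "y * (a * y) = y" by (metis t cay mult.assoc)
  have "a * y * (c' * c) = a * y" by (metis e mult.assoc)
  moreover have "c' * c * (a * y) = c' * c" by (metis cay mult.assoc)
  ultimately show "right_invertible (1 + a * y - c' * c)"
    by (rule right_invertible_one_plus_idem_diff)
  assume "right_inverse_of (1 + a * y - c' * c) v"
  then have v: "(1 + a * y - c' * c) * v = 1" by (simp add: right_inverse_of_def)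
  have "y * (1 + a * y - c' * c) = y"
    using e q by (simp add: right_diff_distrib distrib_left)
  then show "y * v = y" using v by (metis mult.assoc mult_1_right)
qed

lemma bc_inverse_eqI:
  fixes a b c y :: "'a :: {ring, monoid_mult}"
  assumes "is_bc_inverse a b c y"
  shows "bc_inverse a b c = y"
  unfolding bc_inverse_def
  using assms by (blast intro: the_equality is_bc_inverse_unique)

lemma spectral_idem_eqI:
  fixes a b c p q :: "'a :: {ring, monoid_mult}"
  assumes "bc_spectral_pair a b c p q"
  shows "left_spectral_idem a b c = p" "right_spectral_idem a b c = q"
  unfolding left_spectral_idem_def right_spectral_idem_def
  using assms by (blast intro: the_equality dest: bc_spectral_pair_unique)+

theorem theorem2p6:
  fixes a b c :: "'a :: {ring, monoid_mult}"
  shows "(bc_polar a b c \<longleftrightarrow> bc_invertible a b c) \<and>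
    (bc_polar a b c \<longrightarrow>
      (let p = left_spectral_idem a b c;
           q = right_spectral_idem a b c;
           y = bc_inverse a b c
       in p = y * a \<and>
          q = a * y \<and>
          regular_elem b \<and> regular_elem c \<and> regular_elem (c * a * b) \<and>
          (\<forall>b' c' d. inner_inverse b b' \<and> inner_inverse c c' \<and> inner_inverse (c * a * b) d \<longrightarrow>
             left_invertible (1 + p - b * b') \<and>
             right_invertible (1 + q - c' * c) \<and>
             (\<forall>u. left_inverse_of (1 + p - b * b') u \<longrightarrow> y = u * (b * d * c)) \<and>
             (\<forall>v. right_inverse_of (1 + q - c' * c) v \<longrightarrow> y = (b * d * c) * v))))"
proof (intro conjI impI)
  show "bc_polar a b c \<longleftrightarrow> bc_invertible a b c" by (rule bc_polar_iff_bc_invertible)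
next
  assume "bc_polar a b c"
  then obtain y where y: "is_bc_inverse a b c y"
    unfolding bc_polar_iff_bc_invertible bc_invertible_def by blast
  note pair = is_bc_inverse_imp_spectral_pair[OF y]
  show "let p = left_spectral_idem a b c;
           q = right_spectral_idem a b c;
           y = bc_inverse a b c
       in p = y * a \<and>
          q = a * y \<and>
          regular_elem b \<and> regular_elem c \<and> regular_elem (c * a * b) \<and>
          (\<forall>b' c' d. inner_inverse b b' \<and> inner_inverse c c' \<and> inner_inverse (c * a * b) d \<longrightarrow>
             left_invertible (1 + p - b * b') \<and>
             right_invertible (1 + q - c' * c) \<and>
             (\<forall>u. left_inverse_of (1 + p - b * b') u \<longrightarrow> y = u * (b * d * c)) \<and>
             (\<forall>v. right_inverse_of (1 + q - c' * c) v \<longrightarrow> y = (b * d * c) * v))"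
    unfolding Let_def bc_inverse_eqI[OF y] spectral_idem_eqI[OF pair]
    using is_bc_inverse_imp_regular[OF y]
    by (auto simp: is_bc_inverse_eq_sandwich_inner_inverse[OF y]
        is_bc_inverse_left_factor[OF y] is_bc_inverse_right_factor[OF y])
qed

end
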